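(* Let $G$ be a graph and $p\geq 2$ an integer. Let $I_G$ be the set of isolated vertices of $G$, and suppose that $G-I_G$ has at least $p$ vertices. Then $G$ is the competition-common enemy graph of a loopless digraph satisfying Conditions $C(p)$ and $C'(p)$ if and only if $G$ is (isomorphic to) $K_r\cup I_q$ with $r\geq p$ and $q\geq 2$.
   Context: All graphs and digraphs are finite; $K_r$ is the complete graph on $r$ vertices, $I_q$ the edgeless graph on $q$ vertices, and $\cup$ denotes disjoint union. A digraph is loopless if it has no arc of the form $(x,x)$. For a digraph $D$ and vertex $x$, $N^+_D(x)=\{v \mid (x,v)\in A(D)\}$ and $N^-_D(x)=\{v \mid (v,x)\in A(D)\}$. The competition-common enemy graph of $D$ is the simple undirected graph on $V(D)$ in which distinct $x,y$ are adjacent iff $N^+_D(x)\cap N^+_D(y)\neq\emptyset$ and $N^-_D(x)\cap N^-_D(y)\neq\emptyset$. For a vertex set $S$, $\mathcal{F}^+_D(S):=\{x\in S \mid N^+_D(x)\subseteq N^+_D(y)\ \forall y\in S\}$ and $\mathcal{F}^-_D(S):=\{x\in S \mid N^-_D(x)\subseteq N^-_D(y)\ \forall y\in S\}$. For an integer $p\geq2$, $D$ satisfies Condition $C(p)$ (resp. $C'(p)$) if $\mathcal{F}^+_D(S)\neq\emptyset$ (resp. $\mathcal{F}^-_D(S)\neq\emptyset$) for every set $S$ of exactly $p$ vertices of $D$. *)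

theory Defs
  imports "Graph_Theory.Graph_Theory"
begin

text \<open>
  Digraphs are records of type \<open>'a pair_pre_digraph\<close>, whose arcs are ordered pairs of vertices:
  \<open>pair_digraph\<close> is a finite loopless digraph, and \<open>pair_graph\<close> is a finite simple graph, an
  undirected edge being represented by its two opposite arcs.
\<close>

definition out_nbrs :: "'a pair_pre_digraph \<Rightarrow> 'a \<Rightarrow> 'a set" where
  "out_nbrs D x = {v. (x, v) \<in> parcs D}"

definition in_nbrs :: "'a pair_pre_digraph \<Rightarrow> 'a \<Rightarrow> 'a set" where
  "in_nbrs D x = {v. (v, x) \<in> parcs D}"

definition cce_graph :: "'a pair_pre_digraph \<Rightarrow> 'a pair_pre_digraph" where
  "cce_graph D = \<lparr> pverts = pverts D,
     parcs = {(x, y). x \<in> pverts D \<and> y \<in> pverts D \<and> x \<noteq> y \<and>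
       out_nbrs D x \<inter> out_nbrs D y \<noteq> {} \<and> in_nbrs D x \<inter> in_nbrs D y \<noteq> {}} \<rparr>"

definition F_plus :: "'a pair_pre_digraph \<Rightarrow> 'a set \<Rightarrow> 'a set" where
  "F_plus D S = {x \<in> S. \<forall>y\<in>S. out_nbrs D x \<subseteq> out_nbrs D y}"

definition F_minus :: "'a pair_pre_digraph \<Rightarrow> 'a set \<Rightarrow> 'a set" where
  "F_minus D S = {x \<in> S. \<forall>y\<in>S. in_nbrs D x \<subseteq> in_nbrs D y}"

definition condition_C :: "nat \<Rightarrow> 'a pair_pre_digraph \<Rightarrow> bool" where
  "condition_C p D \<longleftrightarrow> (\<forall>S. S \<subseteq> pverts D \<and> card S = p \<longrightarrow> F_plus D S \<noteq> {})"

definition condition_C' :: "nat \<Rightarrow> 'a pair_pre_digraph \<Rightarrow> bool" where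
  "condition_C' p D \<longleftrightarrow> (\<forall>S. S \<subseteq> pverts D \<and> card S = p \<longrightarrow> F_minus D S \<noteq> {})"

definition isolated_verts :: "'a pair_pre_digraph \<Rightarrow> 'a set" where
  "isolated_verts G = {v \<in> pverts G. out_nbrs G v = {} \<and> in_nbrs G v = {}}"

definition complete_graph :: "nat \<Rightarrow> nat pair_pre_digraph" where
  "complete_graph r = \<lparr> pverts = {..<r}, parcs = {(u, v). u < r \<and> v < r \<and> u \<noteq> v} \<rparr>"

definition edgeless_graph :: "nat \<Rightarrow> nat pair_pre_digraph" where
  "edgeless_graph q = \<lparr> pverts = {..<q}, parcs = {} \<rparr>"

definition disjoint_union ::
    "'a pair_pre_digraph \<Rightarrow> 'b pair_pre_digraph \<Rightarrow> ('a + 'b) pair_pre_digraph" where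
  "disjoint_union G H = \<lparr> pverts = pverts G <+> pverts H,
     parcs = map_prod Inl Inl ` parcs G \<union> map_prod Inr Inr ` parcs H \<rparr>"

text \<open>Agreement with the library's notion of complete graph.\<close>

lemma complete_graph_is_complete: "K\<^bsub>r\<^esub> (with_proj (complete_graph r))"
  by (auto simp: complete_digraph_pair_def complete_graph_def)

lemma pair_graph_cce_graph:
  assumes "pair_digraph D"
  shows "pair_graph (cce_graph D)"
proof -
  interpret pair_digraph D by fact
  have "parcs (cce_graph D) \<subseteq> pverts D \<times> pverts D"
    by (auto simp: cce_graph_def)
  then have "finite (parcs (cce_graph D))"
    using pair_finite_verts by (meson finite_SigmaI finite_subset)
  then show ?thesis
    using pair_finite_verts
    by unfold_locales (auto simp: cce_graph_def symmetric_def intro!: symI)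
qed

end

theory Submission
  imports Defs
begin

text \<open>
  A family of sets in which every \<open>p\<close> members include a least one has a least member in every
  subfamily of size at least \<open>p\<close>. Over the non-isolated vertices, whose neighbourhoods are all
  nonempty, the least out- and in-neighbourhoods provide a common prey and a common enemy of all
  of them, so these vertices form a clique. Over all vertices, a nonempty least neighbourhood would
  produce a loop; hence there are a vertex without prey and one without enemies, and if they
  coincide then the same argument applies to the remaining vertices. Conversely, \<open>K\<^sub>r \<union> I\<^sub>q\<close> is
  obtained by letting one isolated vertex \<open>a\<close> dominate the clique and another isolated vertex \<open>b\<close>,
  and letting the clique dominate \<open>b\<close>. The arc from \<open>a\<close> to \<open>b\<close> keeps the neighbourhoods nested.
\<close>

section \<open>Least members of set families\<close>

lemma least_set_if_least_in_subfamilies: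
  fixes N :: "'a \<Rightarrow> 'b set"
  assumes least: "\<And>S. S \<subseteq> T \<Longrightarrow> card S = p \<Longrightarrow> \<exists>x\<in>S. \<forall>y\<in>S. N x \<subseteq> N y"
    and "finite T" "2 \<le> p" "p \<le> card T"
  shows "\<exists>x\<in>T. \<forall>y\<in>T. N x \<subseteq> N y"
proof -
  \<comment> \<open>An inclusion-minimal set \<open>N m\<close> exists by finiteness; it turns out
    to be least.\<close>
  have "finite (N ` T)" "N ` T \<noteq> {}"
    using assms by auto
  then obtain m where "m \<in> T" and min: "\<And>y. y \<in> T \<Longrightarrow> N y \<subseteq> N m \<Longrightarrow> N y = N m"
    using finite_has_minimal[of "N ` T"] by (metis (no_types, lifting) imageE imageI)
  have "N m \<subseteq> N y" if "y \<in> T" for y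
  proof -
    have "card {m, y} \<le> p"
      using \<open>2 \<le> p\<close> card_insert_le_m1[of 2 "{y}" m] by auto
    then obtain S where S: "{m, y} \<subseteq> S" "S \<subseteq> T" "card S = p"
      using exists_subset_between[of "{m, y}" p T] assms(2,4) \<open>m \<in> T\<close> \<open>y \<in> T\<close> by auto
    \<comment> \<open>As \<open>m\<close> is in \<open>S\<close>, \<open>N z\<close> lies in
      \<open>N m\<close>, so the two are equal by minimality. As \<open>y\<close> is in
      \<open>S\<close>, it also lies in \<open>N y\<close>.\<close>
    then obtain z where "z \<in> S" "\<forall>y\<in>S. N z \<subseteq> N y"
      using least by blast
    with S min[of z] show ?thesis
      by auto
  qed
  with \<open>m \<in> T\<close> show ?thesis by blast
qed

lemma least_out_nbrs:
  assumes "condition_C p D" "T \<subseteq> pverts D" "finite T" "2 \<le> p" "p \<le> card T"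
  shows "\<exists>x\<in>T. \<forall>y\<in>T. out_nbrs D x \<subseteq> out_nbrs D y"
proof (rule least_set_if_least_in_subfamilies[where p = p])
  fix S assume "S \<subseteq> T" "card S = p"
  then have "F_plus D S \<noteq> {}"
    using assms(1,2) by (simp add: condition_C_def)
  then show "\<exists>x\<in>S. \<forall>y\<in>S. out_nbrs D x \<subseteq> out_nbrs D y"
    by (auto simp: F_plus_def)
qed (use assms in auto)

lemma least_in_nbrs:
  assumes "condition_C' p D" "T \<subseteq> pverts D" "finite T" "2 \<le> p" "p \<le> card T"
  shows "\<exists>x\<in>T. \<forall>y\<in>T. in_nbrs D x \<subseteq> in_nbrs D y"
proof (rule least_set_if_least_in_subfamilies[where p = p])
  fix S assume "S \<subseteq> T" "card S = p"
  then have "F_minus D S \<noteq> {}"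
    using assms(1,2) by (simp add: condition_C'_def)
  then show "\<exists>x\<in>S. \<forall>y\<in>S. in_nbrs D x \<subseteq> in_nbrs D y"
    by (auto simp: F_minus_def)
qed (use assms in auto)

text \<open>If \<open>x\<close> has the least out-neighbourhood and \<open>v\<close> belongs to it,
  then \<open>v\<close> is in \<open>T\<close>, so its own out-neighbourhood contains
  \<open>v\<close>: a loop. The set \<open>T\<close> is kept general so that a vertex without
  enemies can be removed first.\<close>

lemma (in pair_digraph) ex_out_nbrs_empty:
  assumes "condition_C p G" "T \<subseteq> pverts G" "2 \<le> p" "p \<le> card T"
    and closed: "\<And>u v. (u, v) \<in> parcs G \<Longrightarrow> v \<in> T"
  shows "\<exists>x\<in>T. out_nbrs G x = {}"
proof -
  have "finite T"
    using assms(2) pair_finite_verts finite_subset by blast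
  then obtain x where x: "x \<in> T" "\<forall>y\<in>T. out_nbrs G x \<subseteq> out_nbrs G y"
    using least_out_nbrs assms by meson
  have False if "v \<in> out_nbrs G x" for v
  proof -
    have "v \<in> T"
      using that closed by (auto simp: out_nbrs_def)
    then have "(v, v) \<in> parcs G"
      using that x by (auto simp: out_nbrs_def)
    then show False
      using no_loops' by blast
  qed
  with x show ?thesis by blast
qed

text \<open>The loop argument with arcs reversed, on all vertices; a second isolated vertex will be
  sought among those without prey.\<close>

lemma (in pair_digraph) ex_in_nbrs_empty:
  assumes "condition_C' p G" "2 \<le> p" "p \<le> card (pverts G)"
  shows "\<exists>x\<in>pverts G. in_nbrs G x = {}"
proof -
  obtain x where x: "x \<in> pverts G" "\<forall>y\<in>pverts G. in_nbrs G x \<subseteq> in_nbrs G y"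
    using least_in_nbrs assms pair_finite_verts by blast
  have False if "v \<in> in_nbrs G x" for v
  proof -
    have "(v, v) \<in> parcs G"
      using that x in_arcsD1 by (auto simp: in_nbrs_def)
    then show False
      using no_loops' by blast
  qed
  with x show ?thesis by blast
qed

section \<open>Structure of the competition-common enemy graph\<close>

lemma non_isolated_cce_graph:
  assumes "x \<in> pverts D" "x \<notin> isolated_verts (cce_graph D)"
  shows "out_nbrs D x \<noteq> {}" "in_nbrs D x \<noteq> {}"
  using assms by (auto simp: isolated_verts_def cce_graph_def out_nbrs_def in_nbrs_def)

lemma (in pair_digraph) cce_graph_structure:
  fixes p :: nat
  defines "W \<equiv> pverts G - isolated_verts (cce_graph G)"
  assumes "condition_C p G" "condition_C' p G" "2 \<le> p" "p \<le> card W"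
  shows "parcs (cce_graph G) = {(u, v). u \<in> W \<and> v \<in> W \<and> u \<noteq> v}"
    and "2 \<le> card (pverts G - W)"
proof -
  have W: "W \<subseteq> pverts G" "finite W"
    using pair_finite_verts by (auto simp: W_def)
  obtain x where "x \<in> W" "\<forall>w\<in>W. out_nbrs G x \<subseteq> out_nbrs G w"
    using least_out_nbrs assms W by blast
  moreover have "out_nbrs G x \<noteq> {}"
    using \<open>x \<in> W\<close> non_isolated_cce_graph[of x G] by (simp add: W_def)
  ultimately obtain v where v: "\<forall>w\<in>W. v \<in> out_nbrs G w"
    by blast
  obtain y where "y \<in> W" "\<forall>w\<in>W. in_nbrs G y \<subseteq> in_nbrs G w"
    using least_in_nbrs assms W by blast
  moreover have "in_nbrs G y \<noteq> {}"
    using \<open>y \<in> W\<close> non_isolated_cce_graph[of y G] by (simp add: W_def)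
  ultimately obtain u where u: "\<forall>w\<in>W. u \<in> in_nbrs G w"
    by blast
  show "parcs (cce_graph G) = {(u, v). u \<in> W \<and> v \<in> W \<and> u \<noteq> v}" (is "?L = ?R")
  proof
    show "?L \<subseteq> ?R"
      by (auto simp: W_def cce_graph_def isolated_verts_def out_nbrs_def in_nbrs_def)
    show "?R \<subseteq> ?L"
      using u v W by (auto simp: cce_graph_def)
  qed
  have isolated: "z \<in> pverts G - W"
    if "z \<in> pverts G" "out_nbrs G z = {} \<or> in_nbrs G z = {}" for z
    using that non_isolated_cce_graph[of z G] by (auto simp only: W_def)
  have "p \<le> card (pverts G)"
    using \<open>p \<le> card W\<close> W card_mono[OF pair_finite_verts, of W] by linarith
  then obtain b where b: "b \<in> pverts G" "out_nbrs G b = {}"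
    using ex_out_nbrs_empty[of p "pverts G"] assms in_arcsD2 by auto
  obtain a where a: "a \<in> pverts G" "in_nbrs G a = {}"
    using ex_in_nbrs_empty[OF \<open>condition_C' p G\<close> \<open>2 \<le> p\<close> \<open>p \<le> card (pverts G)\<close>] by blast
  have "\<exists>c \<in> pverts G - W. c \<noteq> a"
  proof (cases "a = b")
    case True
    \<comment> \<open>Deleting \<open>a\<close> keeps all of \<open>W\<close>, hence at least
      \<open>p\<close> vertices. No arc enters \<open>a\<close>, so every arc still ends in the
      remaining set.\<close>
    have "W \<subseteq> pverts G - {a}"
      using isolated[of a] a W by auto
    then have "p \<le> card (pverts G - {a})"
      using \<open>p \<le> card W\<close> card_mono[of "pverts G - {a}" W] pair_finite_verts by simp
    moreover have "v \<in> pverts G - {a}" if "(u, v) \<in> parcs G" for u v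
      using that a in_arcsD2 by (auto simp: in_nbrs_def)
    ultimately obtain c where "c \<in> pverts G - {a}" "out_nbrs G c = {}"
      using ex_out_nbrs_empty[of p "pverts G - {a}"] \<open>condition_C p G\<close> \<open>2 \<le> p\<close> by auto
    then show ?thesis
      using isolated[of c] by auto
  next
    case False
    then show ?thesis
      using b isolated[of b] by auto
  qed
  then obtain c where "{a, c} \<subseteq> pverts G - W" "c \<noteq> a"
    using a isolated[of a] by auto
  then show "2 \<le> card (pverts G - W)"
    using card_mono[of "pverts G - W" "{a, c}"] pair_finite_verts by auto
qed

section \<open>Construction of the digraph\<close>

lemma ex_digraph_cce_graph_clique:
  assumes "pair_graph G" "2 \<le> p" "K \<subseteq> pverts G" "2 \<le> card (pverts G - K)"
    and arcs: "parcs G = {(u, v). u \<in> K \<and> v \<in> K \<and> u \<noteq> v}"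
  shows "\<exists>D. pair_digraph D \<and> condition_C p D \<and> condition_C' p D \<and> G = cce_graph D"
proof -
  interpret pair_graph G by fact
  obtain a b where ab: "a \<in> pverts G - K" "b \<in> pverts G - K" "a \<noteq> b"
    using obtain_subset_with_card_n[OF assms(4)] by (metis card_2_iff insert_subset)
  define D where "D = \<lparr> pverts = pverts G, parcs = {a} \<times> insert b K \<union> K \<times> {b} \<rparr>"
  have verts_D: "pverts D = pverts G"
    by (simp add: D_def)
  \<comment> \<open>The out-neighbourhoods form the chain of \<open>{}\<close>, \<open>{b}\<close>
    and \<open>insert b K\<close>, the last one attained only at \<open>a\<close>. Reversing arcs
    swaps \<open>a\<close> and \<open>b\<close>.\<close>
  have out: "out_nbrs D x = (if x = a then insert b K else if x \<in> K then {b} else {})" for x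
    using ab by (auto simp: D_def out_nbrs_def)
  have in_: "in_nbrs D x = (if x = b then insert a K else if x \<in> K then {a} else {})" for x
    using ab by (auto simp: D_def in_nbrs_def)
  have "finite K"
    using assms(3) pair_finite_verts finite_subset by blast
  then have "pair_digraph D"
    using ab assms(3) pair_finite_verts by unfold_locales (auto simp: D_def)
  moreover have "\<exists>x. x \<in> F_plus D S" if "S \<subseteq> pverts D" "card S = p" for S
  proof -
    have "\<not> S \<subseteq> {a}"
      using that \<open>2 \<le> p\<close> card_mono[of "{a}" S] by auto
    then obtain s where "s \<in> S" "s \<noteq> a"
      by blast
    \<comment> \<open>If \<open>S\<close> leaves \<open>insert a K\<close>, it has a vertex without
      prey; otherwise \<open>s\<close> is in \<open>K\<close> and its set \<open>{b}\<close> is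
      least.\<close>
    then show ?thesis
      by (cases "S \<subseteq> insert a K") (auto simp: F_plus_def out)
  qed
  then have "condition_C p D"
    by (auto simp: condition_C_def)
  moreover have "\<exists>x. x \<in> F_minus D S" if "S \<subseteq> pverts D" "card S = p" for S
  proof -
    have "\<not> S \<subseteq> {b}"
      using that \<open>2 \<le> p\<close> card_mono[of "{b}" S] by auto
    then obtain s where "s \<in> S" "s \<noteq> b"
      by blast
    then show ?thesis
      by (cases "S \<subseteq> insert b K") (auto simp: F_minus_def in_)
  qed
  then have "condition_C' p D"
    by (auto simp: condition_C'_def)
  \<comment> \<open>Vertices of \<open>K\<close> share the prey \<open>b\<close> and the enemy
    \<open>a\<close>. Outside \<open>K\<close>, each vertex lacks prey or enemies and so is
    isolated.\<close>
  moreover have "parcs G = parcs (cce_graph D)"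
    using ab assms(3) unfolding arcs
    by (auto simp: cce_graph_def out in_ verts_D split: if_splits)
  then have "G = cce_graph D"
    by (simp add: cce_graph_def verts_D)
  ultimately show ?thesis by blast
qed

section \<open>Isomorphism with a complete graph plus isolated vertices\<close>

lemma digraph_iso_with_proj_iff:
  assumes "pair_wf_digraph G"
  shows "digraph_iso (with_proj G) (with_proj H) \<longleftrightarrow>
    (\<exists>f. bij_betw f (pverts G) (pverts H) \<and> parcs H = map_prod f f ` parcs G)"
    (is "?L \<longleftrightarrow> ?R")
proof
  interpret pair_wf_digraph G by fact
  assume ?L
  then obtain h where h: "digraph_isomorphism h" "with_proj H = app_iso h (with_proj G)"
    by (auto simp: digraph_iso_def)
  have "iso_tail h = fst" "iso_head h = snd" "pverts H = iso_verts h ` pverts G"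
    and arcs: "parcs H = iso_arcs h ` parcs G"
    using h(2) by (auto simp: with_proj_def app_iso_def)
  \<comment> \<open>An arc is the pair of its endpoints, which \<open>h\<close> respects, so the
    vertex map determines the arc map.\<close>
  moreover from this have "iso_arcs h e = map_prod (iso_verts h) (iso_verts h) e" if "e \<in> parcs G" for e
    using h(1) that by (cases e) (auto simp: digraph_isomorphism_def intro!: prod_eqI)
  ultimately have "bij_betw (iso_verts h) (pverts G) (pverts H)"
    "parcs H = map_prod (iso_verts h) (iso_verts h) ` parcs G"
    using h(1) by (auto simp: digraph_isomorphism_def bij_betw_def)
  then show ?R by blast
next
  interpret pair_wf_digraph G by fact
  assume ?R
  then obtain f where f: "inj_on f (pverts G)" "pverts H = f ` pverts G"
    "parcs H = map_prod f f ` parcs G"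
    by (auto simp: bij_betw_def)
  define h where
    "h = \<lparr>iso_verts = f, iso_arcs = map_prod f f, iso_head = snd, iso_tail = fst\<rparr>"
  have "parcs G \<subseteq> pverts G \<times> pverts G"
    using wellformed' by auto
  then have "inj_on (map_prod f f) (parcs G)"
    using f(1) map_prod_inj_on inj_on_subset by blast
  then have "digraph_isomorphism h"
    using f(1) wf_digraph by (auto simp: digraph_isomorphism_def h_def)
  moreover have "with_proj H = app_iso h (with_proj G)"
    using f by (simp add: with_proj_def app_iso_def h_def)
  ultimately show ?L
    by (auto simp: digraph_iso_def)
qed

text \<open>Reduces the isomorphism to a vertex set \<open>K\<close> within \<open>G\<close>, the
  preimage of the left summand.\<close>

lemma digraph_iso_complete_edgeless_iff:
  assumes "pair_graph G"
  shows "digraph_iso (with_proj G) (with_proj (disjoint_union (complete_graph r) (edgeless_graph q))) \<longleftrightarrow>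
    (\<exists>K \<subseteq> pverts G. card K = r \<and> card (pverts G - K) = q \<and>
      parcs G = {(u, v). u \<in> K \<and> v \<in> K \<and> u \<noteq> v})"
    (is "?L \<longleftrightarrow> ?R")
proof -
  interpret pair_graph G by fact
  \<comment> \<open>All arcs come from the left summand; writing them over its image under
    \<open>Inl\<close> gives the same shape as the clique on \<open>K\<close>.\<close>
  have union: "pverts (disjoint_union (complete_graph r) (edgeless_graph q)) = {..<r} <+> {..<q}"
    "parcs (disjoint_union (complete_graph r) (edgeless_graph q)) =
      {(u, v). u \<in> Inl ` {..<r} \<and> v \<in> Inl ` {..<r} \<and> u \<noteq> v}"
    by (auto simp: disjoint_union_def complete_graph_def edgeless_graph_def)
  note iso = digraph_iso_with_proj_iff[OF pair_wf_digraph, of "disjoint_union _ _", unfolded union]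
  show ?thesis
  proof
    assume ?L
    then obtain f where f: "bij_betw f (pverts G) ({..<r} <+> {..<q})"
      and arcs: "{(u, v). u \<in> Inl ` {..<r} \<and> v \<in> Inl ` {..<r} \<and> u \<noteq> v} = map_prod f f ` parcs G"
      unfolding iso union by auto
    define K where "K = {x \<in> pverts G. f x \<in> Inl ` {..<r}}"
    have K: "K \<subseteq> pverts G"
      by (auto simp: K_def)
    have inj: "inj_on f (pverts G)" and img: "f ` pverts G = {..<r} <+> {..<q}"
      using f by (auto simp: bij_betw_def)
    have "f ` K = Inl ` {..<r}"
    proof (intro equalityI subsetI)
      fix z :: "nat + nat" assume z: "z \<in> Inl ` {..<r}"
      then have "z \<in> f ` pverts G"
        unfolding img by auto
      then obtain x where "x \<in> pverts G" "z = f x"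
        by (rule imageE)
      with z show "z \<in> f ` K"
        by (simp add: K_def)
    next
      fix z assume "z \<in> f ` K"
      then obtain x where "x \<in> K" "z = f x"
        by (rule imageE)
      then show "z \<in> Inl ` {..<r}"
        by (simp add: K_def)
    qed
    then have "card K = r"
      using card_image[OF inj_on_subset[OF inj K]] by (simp add: card_image)
    moreover have "card (pverts G) = r + q"
      using bij_betw_same_card[OF f] by (simp add: card_Plus)
    then have "card (pverts G - K) = q"
      using \<open>card K = r\<close> K card_Diff_subset[of K "pverts G"] pair_finite_verts finite_subset[OF K]
      by simp
    moreover have "(u, v) \<in> parcs G \<longleftrightarrow> u \<in> K \<and> v \<in> K \<and> u \<noteq> v" for u v
    proof
      assume uv: "(u, v) \<in> parcs G"
      then have "(f u, f v) \<in> map_prod f f ` parcs G"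
        by (auto intro!: image_eqI[of _ _ "(u, v)"])
      then show "u \<in> K \<and> v \<in> K \<and> u \<noteq> v"
        using uv wellformed' unfolding arcs[symmetric] by (auto simp: K_def)
    next
      assume uv: "u \<in> K \<and> v \<in> K \<and> u \<noteq> v"
      then have "f u \<noteq> f v"
        using inj K by (meson inj_onD subsetD)
      with uv have "(f u, f v) \<in> map_prod f f ` parcs G"
        unfolding arcs[symmetric] by (auto simp: K_def)
      \<comment> \<open>The image arc may come from another pair a priori; injectivity of
        \<open>f\<close> on the vertices identifies it with \<open>(u, v)\<close>.\<close>
      then obtain u' v' where *: "(u', v') \<in> parcs G" "f u = f u'" "f v = f v'"
        by auto
      then have "u = u'" "v = v'"
        using inj uv K wellformed' by (meson inj_onD subsetD)+
      with * show "(u, v) \<in> parcs G"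
        by simp
    qed
    then have "parcs G = {(u, v). u \<in> K \<and> v \<in> K \<and> u \<noteq> v}"
      by auto
    ultimately show ?R
      using K by blast
  next
    assume ?R
    then obtain K where K: "K \<subseteq> pverts G" "card K = r" "card (pverts G - K) = q"
      and arcs: "parcs G = {(u, v). u \<in> K \<and> v \<in> K \<and> u \<noteq> v}"
      by blast
    have "finite K" "finite (pverts G - K)"
      using finite_subset[OF K(1)] pair_finite_verts by auto
    then obtain g h where g: "bij_betw g K {..<r}" and h: "bij_betw h (pverts G - K) {..<q}"
      using K ex_bij_betw_finite_nat by (metis atLeast0LessThan)
    \<comment> \<open>Numberings of \<open>K\<close> and of its complement are glued; the distinct
      summands keep the result injective.\<close>
    define f where "f x = (if x \<in> K then Inl (g x) else Inr (h x))" for x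
    have injf: "inj_on f (pverts G)"
      using g h by (auto simp: inj_on_def f_def bij_betw_def)
    have fK: "f ` K = Inl ` {..<r}"
      using g by (auto simp: f_def bij_betw_def)
    have "f ` (pverts G - K) = Inr ` {..<q}"
      using h by (auto simp: f_def bij_betw_def)
    with fK have "f ` pverts G = {..<r} <+> {..<q}"
      using K(1) unfolding Plus_def by (metis Diff_partition image_Un)
    then have "bij_betw f (pverts G) ({..<r} <+> {..<q})"
      using injf by (simp add: bij_betw_def)
    moreover have "{(u, v). u \<in> Inl ` {..<r} \<and> v \<in> Inl ` {..<r} \<and> u \<noteq> v} = map_prod f f ` parcs G"
      using inj_on_subset[OF injf K(1)] unfolding arcs fK[symmetric]
      by (auto simp: inj_on_def image_iff)
    ultimately show ?L
      unfolding iso union by auto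
  qed
qed

theorem theorem2p6:
  fixes G :: "'a pair_pre_digraph" and p :: nat
  assumes "pair_graph G"
    and "p \<ge> 2"
    and "card (verts (with_proj G \<restriction> (pverts G - isolated_verts G))) \<ge> p"
  shows "(\<exists>D. pair_digraph D \<and> condition_C p D \<and> condition_C' p D \<and> G = cce_graph D) \<longleftrightarrow>
    (\<exists>r q. r \<ge> p \<and> q \<ge> 2 \<and>
      digraph_iso (with_proj G) (with_proj (disjoint_union (complete_graph r) (edgeless_graph q))))"
    (is "?L \<longleftrightarrow> ?R")
proof
  assume ?L
  then obtain D where D: "pair_digraph D" "condition_C p D" "condition_C' p D" "G = cce_graph D"
    by blast
  interpret D: pair_digraph D by fact
  have verts: "pverts (cce_graph D) = pverts D"
    by (simp add: cce_graph_def)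
  define W where "W = pverts D - isolated_verts (cce_graph D)"
  have "p \<le> card W"
    using assms(3) by (simp add: W_def verts D(4))
  moreover from this have "2 \<le> card (pverts G - W)"
    "parcs G = {(u, v). u \<in> W \<and> v \<in> W \<and> u \<noteq> v}"
    using D.cce_graph_structure[of p] D(2,3) assms(2) by (simp_all add: W_def verts D(4))
  moreover have "W \<subseteq> pverts G"
    by (auto simp: W_def verts D(4))
  \<comment> \<open>Here \<open>W\<close> serves as \<open>K\<close>, with \<open>r\<close> and
    \<open>q\<close> the sizes of \<open>W\<close> and of its complement.\<close>
  ultimately show ?R
    using digraph_iso_complete_edgeless_iff[OF assms(1)] by blast
next
  assume ?R
  \<comment> \<open>The \<open>q\<close> vertices outside the clique supply the two needed by the
    construction.\<close>
  then show ?L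
    using ex_digraph_cce_graph_clique[OF assms(1,2)]
    by (auto simp: digraph_iso_complete_edgeless_iff[OF assms(1)])
qed

end
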